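(* Let $B \subset \mathbb{R}^d$ be a convex body and let $C_1, \ldots, C_n \subset \mathbb{R}^d$ be convex sets that permit a translative covering of $B$. Assume that for every $i \in \{1,\ldots,n\}$ there exists some $o_i \in \mathbb{R}^d$ such that $r_B(C_i) B - o_i$ and $C_i - o_i$ have a complete set of contact pairs $W_i \subset \mathbb{R}^d \times \mathbb{R}^d$ with $(0,0) \in \operatorname{conv} W_i$, so that for any two such contact pairs $(u_i, v_i) \in W_i$, $(u_j, v_j) \in W_j$ with $i \ne j$, $$\langle u_i, v_j \rangle = \langle u_j, v_i \rangle$$ holds. Then $$\sum_{i=1}^n r_B(C_i) \ge 1.$$
   Context: A convex body is a compact convex set with nonempty interior. Convex sets $C_1,\ldots,C_n \subset \mathbb{R}^d$ permit a translative covering of a convex body $B$ if $B \subset \bigcup_{i=1}^n (C_i + x_i)$ for some $x_1,\ldots,x_n \in \mathbb{R}^d$. For a convex body $K \subset \mathbb{R}^d$ and a convex set $L \subset \mathbb{R}^d$, the $K$-inradius of $L$ is $r_K(L) = \sup\{\lambda \ge 0 : \lambda K + x \subset L \text{ for some } x \in \mathbb{R}^d\}$. Contact pairs: let $K'$ be a maximal homothetic copy of a convex body $K$ inscribed in a convex set $L$ (i.e. $K' \subset L$ is a translate of $r_K(L) K$). A contact pair of $K'$ and $L$ is a pair $(u,v)$ with $u \in \mathbb{R}^d$, $v \in \mathbb{R}^d \setminus \{0\}$, where $u$ is a common boundary point of $K'$ and $L$ and $v$ is a common outer normal vector of $K'$ and $L$ at $u$ (i.e. $\langle x, v\rangle \le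 \langle u, v \rangle$ for all $x \in L$, hence for all $x \in K'$). A finite set of contact pairs $\{(u_1,v_1),\ldots,(u_m,v_m)\}$ is complete if $0 \in \operatorname{conv}\{v_1,\ldots,v_m\}$. In the hypothesis, these notions are applied with $K = B$, $K' = r_B(C_i)B - o_i$ and $L = C_i - o_i$. *)

theory Defs
  imports "HOL-Analysis.Analysis"
begin

definition convex_body :: "'a::euclidean_space set \<Rightarrow> bool" where
  "convex_body K \<longleftrightarrow> compact K \<and> convex K \<and> interior K \<noteq> {}"

definition permits_translative_covering ::
  "nat \<Rightarrow> (nat \<Rightarrow> 'a::euclidean_space set) \<Rightarrow> 'a set \<Rightarrow> bool" where
  "permits_translative_covering n C B \<longleftrightarrow>
     (\<exists>x. B \<subseteq> (\<Union>i\<in>{1..n}. (\<lambda>y. y + x i) ` C i))"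

text \<open>
  The inradius is extended-real-valued, since \<open>L\<close> may be unbounded and contain arbitrarily
  large homothetic copies of \<open>K\<close>.
\<close>

definition inradius :: "'a::euclidean_space set \<Rightarrow> 'a set \<Rightarrow> ereal" where
  "inradius K L =
     (SUP l \<in> {l::real. 0 \<le> l \<and> (\<exists>x. (\<lambda>y. l *\<^sub>R y + x) ` K \<subseteq> L)}. ereal l)"

text \<open>A maximal homothetic copy exists only if the inradius is finite.\<close>

definition maximal_inscribed_copy ::
  "'a::euclidean_space set \<Rightarrow> 'a set \<Rightarrow> 'a set \<Rightarrow> bool" where
  "maximal_inscribed_copy K L K' \<longleftrightarrow>
     K' \<subseteq> L \<and> (\<exists>r x. inradius K L = ereal r \<and> K' = (\<lambda>y. r *\<^sub>R y + x) ` K)"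

definition contact_pair ::
  "'a::euclidean_space set \<Rightarrow> 'a set \<Rightarrow> 'a \<times> 'a \<Rightarrow> bool" where
  "contact_pair K' L = (\<lambda>(u, v).
     v \<noteq> 0 \<and> u \<in> frontier K' \<and> u \<in> frontier L \<and>
     (\<forall>x\<in>K'. x \<bullet> v \<le> u \<bullet> v) \<and> (\<forall>x\<in>L. x \<bullet> v \<le> u \<bullet> v))"

definition complete_contact_pairs ::
  "'a::euclidean_space set \<Rightarrow> 'a set \<Rightarrow> ('a \<times> 'a) set \<Rightarrow> bool" where
  "complete_contact_pairs K' L W \<longleftrightarrow>
     finite W \<and> (\<forall>w\<in>W. contact_pair K' L w) \<and> 0 \<in> convex hull (snd ` W)"

end

theory Submission
  imports Defs
begin

text \<open>
  This is Bang's argument. Choose one contact pair \<open>(u i, v i)\<close> from each \<open>W i\<close> and look at the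
  points \<open>y + t * (\<Sum>i. u i)\<close>. If the inradii sum up to less than \<open>1\<close>, then for some \<open>t > 1\<close> and a
  suitable \<open>y\<close> all these points lie in \<open>B\<close>. By the symmetry hypothesis, the amounts by which the
  point violates the constraints of the \<open>v i\<close> are the coordinatewise variations of one function of
  the choice. Since \<open>0\<close> lies in the convex hull of the normals, each of these amounts is positive
  for some pair of \<open>W i\<close>, so a maximizing choice produces an uncovered point. Sets of inradius \<open>0\<close>
  are negligible and can be dropped from the covering beforehand.
\<close>

section \<open>Bang's maximization argument\<close>

text \<open>A potential argument: \<open>k\<close> maximizes one function \<open>G\<close> over the
  finite product \<open>Pi\<^sub>E I W\<close>, and changing a single coordinate of \<open>k\<close>
  changes \<open>G\<close> by exactly twice the change of the local expression.\<close>

lemma ex_coordinatewise_max: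
  fixes g :: "'i \<Rightarrow> 'w \<Rightarrow> real" and q :: "'i \<Rightarrow> 'i \<Rightarrow> 'w \<Rightarrow> 'w \<Rightarrow> real"
  assumes fin: "finite I" and W: "\<And>i. i \<in> I \<Longrightarrow> finite (W i) \<and> W i \<noteq> {}"
    and sym: "\<And>i j w w'. i \<in> I \<Longrightarrow> j \<in> I \<Longrightarrow> i \<noteq> j \<Longrightarrow> w \<in> W i \<Longrightarrow> w' \<in> W j \<Longrightarrow> q i j w w' = q j i w' w"
  obtains k where "\<And>i. i \<in> I \<Longrightarrow> k i \<in> W i"
    and "\<And>i w. i \<in> I \<Longrightarrow> w \<in> W i \<Longrightarrow>
           g i w + (\<Sum>j\<in>I-{i}. q i j w (k j)) \<le> g i (k i) + (\<Sum>j\<in>I-{i}. q i j (k i) (k j))"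
proof -
  \<comment> \<open>The double sum meets each unordered pair twice, with equal values by symmetry of
    \<open>q\<close>; the factor 2 gives \<open>g\<close> the same weight.\<close>
  define G where "G k = (\<Sum>i\<in>I. 2 * g i (k i) + (\<Sum>j\<in>I-{i}. q i j (k i) (k j)))" for k
  let ?P = "Pi\<^sub>E I W"
  have "finite ?P" "?P \<noteq> {}"
    using fin W by (auto intro: finite_PiE simp: PiE_eq_empty_iff)
  then obtain k where k: "k \<in> ?P" and max: "\<And>k'. k' \<in> ?P \<Longrightarrow> G k' \<le> G k"
    using obtains_MAX[of ?P G] by (metis Max_ge finite_imageI imageI)
  \<comment> \<open>Only the first summand depends on \<open>k' i\<close>; the second stays fixed
    when coordinate \<open>i\<close> is replaced.\<close>
  have split: "G k' = 2 * (g i (k' i) + (\<Sum>j\<in>I-{i}. q i j (k' i) (k' j)))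
      + (\<Sum>j\<in>I-{i}. 2 * g j (k' j) + (\<Sum>l\<in>I-{j}-{i}. q j l (k' j) (k' l)))"
    if i: "i \<in> I" and k': "k' \<in> ?P" for i k'
  proof -
    have "(\<Sum>j\<in>I-{i}. 2 * g j (k' j) + (\<Sum>l\<in>I-{j}. q j l (k' j) (k' l)))
        = (\<Sum>j\<in>I-{i}. q i j (k' i) (k' j)
            + (2 * g j (k' j) + (\<Sum>l\<in>I-{j}-{i}. q j l (k' j) (k' l))))"
    proof (rule sum.cong)
      fix j assume j: "j \<in> I - {i}"
      have "(\<Sum>l\<in>I-{j}. q j l (k' j) (k' l))
          = q j i (k' j) (k' i) + (\<Sum>l\<in>I-{j}-{i}. q j l (k' j) (k' l))"
        using i j fin by (subst sum.remove[of _ i]) auto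
      moreover have "q j i (k' j) (k' i) = q i j (k' i) (k' j)"
        using i j k' by (intro sym) auto
      ultimately show "2 * g j (k' j) + (\<Sum>l\<in>I-{j}. q j l (k' j) (k' l))
          = q i j (k' i) (k' j) + (2 * g j (k' j) + (\<Sum>l\<in>I-{j}-{i}. q j l (k' j) (k' l)))"
        by simp
    qed simp
    then show ?thesis
      unfolding G_def sum.remove[OF fin i] by (simp add: sum.distrib algebra_simps)
  qed
  show thesis
  proof (rule that)
    show "k i \<in> W i" if "i \<in> I" for i
      using k that by auto
    fix i w assume i: "i \<in> I" and w: "w \<in> W i"
    define k' where "k' = k(i := w)"
    have k': "k' \<in> ?P"
      using k i w by (auto simp: k'_def PiE_iff extensional_def)
    have "(\<Sum>j\<in>I-{i}. 2 * g j (k' j) + (\<Sum>l\<in>I-{j}-{i}. q j l (k' j) (k' l)))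
        = (\<Sum>j\<in>I-{i}. 2 * g j (k j) + (\<Sum>l\<in>I-{j}-{i}. q j l (k j) (k l)))"
      by (intro sum.cong arg_cong2[where f="(+)"]) (auto simp: k'_def)
    moreover have "(\<Sum>j\<in>I-{i}. q i j w (k' j)) = (\<Sum>j\<in>I-{i}. q i j w (k j))"
      by (intro sum.cong) (auto simp: k'_def)
    moreover have "k' i = w" by (simp add: k'_def)
    ultimately show "g i w + (\<Sum>j\<in>I-{i}. q i j w (k j))
        \<le> g i (k i) + (\<Sum>j\<in>I-{i}. q i j (k i) (k j))"
      using max[OF k'] split[OF i k] split[OF i k'] by simp
  qed
qed

text \<open>Otherwise \<open>S\<close>, and with it its convex hull, would lie in an open half-space
  that misses 0.\<close>

lemma zero_in_convex_hull_ex_inner_nonneg: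
  fixes a :: "'a::real_inner"
  assumes "0 \<in> convex hull S"
  obtains v where "v \<in> S" "0 \<le> a \<bullet> v"
proof (rule ccontr)
  assume "\<not> thesis"
  with that have "S \<subseteq> {v. a \<bullet> v < 0}" by force
  then have "convex hull S \<subseteq> {v. a \<bullet> v < 0}"
    by (rule hull_minimal) (rule convex_halfspace_lt)
  with assms show False by auto
qed

lemma bang_lemma:
  fixes W :: "'i \<Rightarrow> ('a::real_inner \<times> 'a) set" and x z :: "'i \<Rightarrow> 'a"
  assumes fin: "finite I" "\<And>i. i \<in> I \<Longrightarrow> finite (W i)"
    and hull: "\<And>i. i \<in> I \<Longrightarrow> 0 \<in> convex hull (snd ` W i)"
    and sym: "\<And>i j u v u' v'. i \<in> I \<Longrightarrow> j \<in> I \<Longrightarrow> i \<noteq> j \<Longrightarrow> (u, v) \<in> W i \<Longrightarrow> (u', v') \<in> W j \<Longrightarrow>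
                u \<bullet> v' = u' \<bullet> v"
    and z: "\<And>i u v. i \<in> I \<Longrightarrow> (u, v) \<in> W i \<Longrightarrow> z i \<bullet> v < u \<bullet> v"
    and t: "1 < t"
  obtains k where "\<And>i. i \<in> I \<Longrightarrow> k i \<in> W i"
    and "\<And>i. i \<in> I \<Longrightarrow> fst (k i) \<bullet> snd (k i) < ((\<Sum>j\<in>I. t *\<^sub>R fst (k j)) - x i) \<bullet> snd (k i)"
proof -
  \<comment> \<open>With these choices \<open>g i w\<close> plus the off-diagonal sum of
    \<open>q\<close> is the amount by which the shifted point violates the constraint of
    \<open>w\<close>; \<open>g\<close> absorbs the diagonal term \<open>t * (u \<bullet> v)\<close>
    and the bound \<open>u \<bullet> v\<close>.\<close>
  define g where "g i w = (t - 1) * (fst w \<bullet> snd w) - x i \<bullet> snd w" for i and w :: "'a \<times> 'a"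
  define q where "q i j w w' = t * (fst w' \<bullet> snd w)" for i j :: 'i and w w' :: "'a \<times> 'a"
  have ne: "W i \<noteq> {}" if "i \<in> I" for i
    using hull[OF that] by auto
  obtain k where k: "\<And>i. i \<in> I \<Longrightarrow> k i \<in> W i"
    and max: "\<And>i w. i \<in> I \<Longrightarrow> w \<in> W i \<Longrightarrow>
       g i w + (\<Sum>j\<in>I-{i}. q i j w (k j)) \<le> g i (k i) + (\<Sum>j\<in>I-{i}. q i j (k i) (k j))"
  proof (rule ex_coordinatewise_max[of I W q g])
    show "q i j w w' = q j i w' w"
      if "i \<in> I" "j \<in> I" "i \<noteq> j" "w \<in> W i" "w' \<in> W j" for i j w w'
      using sym[of i j "fst w" "snd w" "fst w'" "snd w'"] that by (simp add: q_def)
  qed (use fin ne in auto)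
  show thesis
  proof (rule that[OF k])
    fix i assume i: "i \<in> I"
    let ?s = "\<Sum>j\<in>I-{i}. t *\<^sub>R fst (k j)"
    have eq: "g i w + (\<Sum>j\<in>I-{i}. q i j w (k j))
        = (t - 1) * (fst w \<bullet> snd w) + (?s - x i) \<bullet> snd w" for w
      by (simp add: g_def q_def inner_diff_left inner_sum_left)
    \<comment> \<open>The vector is the same for all \<open>w\<close>, so completeness applies to
      it. Replacing \<open>z i\<close> by \<open>fst w\<close> then makes the inequality strict
      because \<open>t > 1\<close>, and the maximizer inherits positivity.\<close>
    obtain w where w: "w \<in> W i" and nn: "0 \<le> ((t - 1) *\<^sub>R z i + (?s - x i)) \<bullet> snd w"
      using zero_in_convex_hull_ex_inner_nonneg[OF hull[OF i], of "(t - 1) *\<^sub>R z i + (?s - x i)"]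
      by blast
    have "(t - 1) * (z i \<bullet> snd w) < (t - 1) * (fst w \<bullet> snd w)"
      using z[OF i, of "fst w" "snd w"] w t by simp
    with nn have "0 < (t - 1) * (fst w \<bullet> snd w) + (?s - x i) \<bullet> snd w"
      by (simp add: inner_add_left)
    also have "\<dots> \<le> (t - 1) * (fst (k i) \<bullet> snd (k i)) + (?s - x i) \<bullet> snd (k i)"
      using max[OF i w] unfolding eq .
    finally show "fst (k i) \<bullet> snd (k i) < ((\<Sum>j\<in>I. t *\<^sub>R fst (k j)) - x i) \<bullet> snd (k i)"
      unfolding sum.remove[OF fin(1) i] by (simp add: algebra_simps inner_add_left inner_diff_left)
  qed
qed

section \<open>Inradii, contact pairs and sets of inradius 0\<close>

lemma inradius_translate: "inradius K ((\<lambda>y. y - c) ` L) = inradius K L"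
proof -
  have "(\<exists>x. (\<lambda>y. l *\<^sub>R y + x) ` K \<subseteq> (\<lambda>y. y - c) ` L) \<longleftrightarrow> (\<exists>x. (\<lambda>y. l *\<^sub>R y + x) ` K \<subseteq> L)"
    (is "?A \<longleftrightarrow> ?B") for l :: real
  proof
    assume ?A
    then obtain x where x: "(\<lambda>y. l *\<^sub>R y + x) ` K \<subseteq> (\<lambda>y. y - c) ` L" ..
    have "(\<lambda>y. l *\<^sub>R y + (x + c)) ` K = (\<lambda>y. y + c) ` (\<lambda>y. l *\<^sub>R y + x) ` K"
      by (simp add: image_image add.assoc)
    also have "\<dots> \<subseteq> (\<lambda>y. y + c) ` (\<lambda>y. y - c) ` L"
      using x by (rule image_mono)
    also have "\<dots> = L" by (simp add: image_image)
    finally show ?B by blast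
  next
    assume ?B
    then obtain x where x: "(\<lambda>y. l *\<^sub>R y + x) ` K \<subseteq> L" ..
    have "(\<lambda>y. l *\<^sub>R y + (x - c)) ` K = (\<lambda>y. y - c) ` (\<lambda>y. l *\<^sub>R y + x) ` K"
      by (simp add: image_image algebra_simps)
    with x show ?A by (metis image_mono)
  qed
  then show ?thesis unfolding inradius_def by simp
qed

lemma inradius_nonneg_real:
  assumes "inradius K L = ereal r"
  shows "0 \<le> r"
proof -
  let ?S = "{l::real. 0 \<le> l \<and> (\<exists>x. (\<lambda>y. l *\<^sub>R y + x) ` K \<subseteq> L)}"
  \<comment> \<open>The supremum of the empty set is minus infinity in \<open>ereal\<close>, hence
    not a real number.\<close>
  have "?S \<noteq> {}"
  proof
    assume "?S = {}"
    then have "inradius K L = (SUP l\<in>({}::real set). ereal l)" unfolding inradius_def by (rule arg_cong)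
    then show False using assms by (simp add: bot_ereal_def)
  qed
  then obtain l where l: "l \<in> ?S" by blast
  then have "ereal l \<le> inradius K L" unfolding inradius_def by (rule SUP_upper)
  with l assms show ?thesis by simp
qed

text \<open>From an interior point one can still move a little in direction \<open>v\<close> inside
  \<open>B\<close>, and since \<open>r > 0\<close> this strictly increases the inner product with
  \<open>v\<close>.\<close>

lemma contact_pair_interior_less:
  fixes B :: "'a::euclidean_space set"
  assumes cp: "contact_pair ((\<lambda>y. r *\<^sub>R y - c) ` B) L (u, v)" and r: "0 < r" and b: "b \<in> interior B"
  shows "(r *\<^sub>R b - c) \<bullet> v < u \<bullet> v"
proof -
  from cp have v: "v \<noteq> 0" and le: "\<And>y. y \<in> B \<Longrightarrow> (r *\<^sub>R y - c) \<bullet> v \<le> u \<bullet> v"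
    by (auto simp: contact_pair_def)
  from b obtain e where e: "e > 0" "cball b e \<subseteq> B"
    by (auto simp: mem_interior_cball)
  let ?d = "e / norm v"
  have "b + ?d *\<^sub>R v \<in> cball b e"
    using v e by (simp add: dist_norm)
  then have "(r *\<^sub>R (b + ?d *\<^sub>R v) - c) \<bullet> v \<le> u \<bullet> v"
    using e le by blast
  moreover have "0 < r * ?d * (v \<bullet> v)"
    using r e v by simp
  ultimately show ?thesis
    by (simp add: inner_diff_left inner_add_left scaleR_add_right)
qed

text \<open>For inradius 0 the inscribed copy is one point \<open>p\<close>, so all contact points
  coincide. Each point of \<open>L\<close> then has inner product at least that of \<open>p\<close>
  with some normal, so it lies on one of finitely many hyperplanes through \<open>p\<close>.\<close>

lemma negligible_of_point_contact:
  fixes L :: "'a::euclidean_space set"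
  assumes W: "finite W" "0 \<in> convex hull (snd ` W)"
    and v: "\<And>u v. (u, v) \<in> W \<Longrightarrow> v \<noteq> 0 \<and> (\<forall>x\<in>L. x \<bullet> v \<le> p \<bullet> v)"
  shows "negligible L"
proof (rule negligible_subset)
  show "negligible (\<Union>v\<in>snd ` W. {x. v \<bullet> x = v \<bullet> p})"
    using W v by (intro negligible_Union) (auto intro!: negligible_hyperplane)
  show "L \<subseteq> (\<Union>v\<in>snd ` W. {x. v \<bullet> x = v \<bullet> p})"
  proof
    fix x assume x: "x \<in> L"
    obtain v' where v': "v' \<in> snd ` W" "0 \<le> (x - p) \<bullet> v'"
      using zero_in_convex_hull_ex_inner_nonneg[OF W(2)] by blast
    then have "x \<bullet> v' \<le> p \<bullet> v'" using v x by auto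
    with v' have "v' \<bullet> x = v' \<bullet> p" by (simp add: inner_diff_right inner_commute)
    with v' show "x \<in> (\<Union>v\<in>snd ` W. {x. v \<bullet> x = v \<bullet> p})" by blast
  qed
qed

text \<open>The part of the interior outside \<open>D\<close> is open and negligible, hence empty; a
  convex body is contained in the closure of its interior.\<close>

lemma convex_body_subset_closed_Un_negligible:
  fixes B :: "'a::euclidean_space set"
  assumes B: "convex_body B" and D: "closed D" and N: "negligible N" and sub: "B \<subseteq> D \<union> N"
  shows "B \<subseteq> D"
proof -
  have "interior B - D \<subseteq> N" using sub interior_subset by blast
  then have "negligible (interior B - D)" using N negligible_subset by blast
  moreover have "open (interior B - D)" using D by (intro open_Diff) auto
  ultimately have "interior B \<subseteq> D" using open_not_negligible by blast
  then have "closure (interior B) \<subseteq> D" using D by (rule closure_minimal)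
  moreover have "closure (interior B) = closure B"
    using B by (intro convex_closure_interior) (auto simp: convex_body_def)
  ultimately show ?thesis using closure_subset by blast
qed

section \<open>An uncovered point when the inradii sum to less than 1\<close>

theorem theorem2:
  fixes B :: "(real ^ 'd) set"
    and n :: nat
    and C :: "nat \<Rightarrow> (real ^ 'd) set"
    and c :: "nat \<Rightarrow> real ^ 'd"
    and W :: "nat \<Rightarrow> ((real ^ 'd) \<times> (real ^ 'd)) set"
  assumes "convex_body B"
    and "\<And>i. i \<in> {1..n} \<Longrightarrow> convex (C i)"
    and "permits_translative_covering n C B"
    and "\<And>i. i \<in> {1..n} \<Longrightarrow>
           maximal_inscribed_copy B ((\<lambda>y. y - c i) ` C i)
             ((\<lambda>y. real_of_ereal (inradius B (C i)) *\<^sub>R y - c i) ` B)"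
    and "\<And>i. i \<in> {1..n} \<Longrightarrow>
           complete_contact_pairs
             ((\<lambda>y. real_of_ereal (inradius B (C i)) *\<^sub>R y - c i) ` B)
             ((\<lambda>y. y - c i) ` C i) (W i)"
    and "\<And>i. i \<in> {1..n} \<Longrightarrow> (0, 0) \<in> convex hull (W i)"
    and "\<And>i j ui vi uj vj. i \<in> {1..n} \<Longrightarrow> j \<in> {1..n} \<Longrightarrow> i \<noteq> j \<Longrightarrow>
           (ui, vi) \<in> W i \<Longrightarrow> (uj, vj) \<in> W j \<Longrightarrow> ui \<bullet> vj = uj \<bullet> vi"
  shows "(\<Sum>i=1..n. inradius B (C i)) \<ge> 1"
proof -
  note B = assms(1) and cp = assms(5) and sym = assms(7)
  from B have cB: "compact B" and convB: "convex B" and intB: "interior B \<noteq> {}"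
    by (auto simp: convex_body_def)
  define r where "r i = real_of_ereal (inradius B (C i))" for i
  have inr: "inradius B (C i) = ereal (r i)" and r0: "0 \<le> r i" if "i \<in> {1..n}" for i
  proof -
    from assms(4)[OF that] show *: "inradius B (C i) = ereal (r i)"
      by (auto simp: maximal_inscribed_copy_def inradius_translate r_def)
    show "0 \<le> r i" using inradius_nonneg_real[OF *] .
  qed
  from assms(3) obtain x where cov: "B \<subseteq> (\<Union>i\<in>{1..n}. (\<lambda>y. y + x i) ` C i)"
    by (auto simp: permits_translative_covering_def)
  have finW: "finite (W i)" and hullW: "0 \<in> convex hull (snd ` W i)"
    and cW: "\<And>u v. (u, v) \<in> W i \<Longrightarrow>
        contact_pair ((\<lambda>y. r i *\<^sub>R y - c i) ` B) ((\<lambda>y. y - c i) ` C i) (u, v)"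
    if "i \<in> {1..n}" for i
    using cp[OF that] by (auto simp: complete_contact_pairs_def r_def)
  have inB: "\<exists>b\<in>B. u = r i *\<^sub>R b - c i" if "i \<in> {1..n}" "(u, v) \<in> W i" for i u v
  proof -
    have "compact ((\<lambda>y. r i *\<^sub>R y - c i) ` B)"
      by (intro compact_continuous_image continuous_intros cB)
    then have "frontier ((\<lambda>y. r i *\<^sub>R y - c i) ` B) \<subseteq> (\<lambda>y. r i *\<^sub>R y - c i) ` B"
      by (intro frontier_subset_closed compact_imp_closed)
    then show ?thesis using cW[OF that] by (auto simp: contact_pair_def)
  qed
  define I where "I = {i\<in>{1..n}. 0 < r i}"
  have I: "finite I" "I \<subseteq> {1..n}" by (auto simp: I_def)
  \<comment> \<open>The closed polyhedron cut out by the contact constraints, moved to the position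
    of \<open>C i\<close> in the covering. The shift is \<open>x i + c i\<close> since
    \<open>W i\<close> refers to \<open>C i\<close> translated by \<open>- c i\<close>.\<close>
  define D where "D i = {y. \<forall>(u, v)\<in>W i. (y - x i - c i) \<bullet> v \<le> u \<bullet> v}" for i
  have "B \<subseteq> (\<Union>i\<in>I. D i)"
  proof (rule convex_body_subset_closed_Un_negligible[OF B])
    have "closed (D i)" for i
    proof -
      have "D i = (\<Inter>w\<in>W i. {y. (y - x i - c i) \<bullet> snd w \<le> fst w \<bullet> snd w})"
        by (force simp: D_def)
      moreover have "closed {y. (y - x i - c i) \<bullet> snd w \<le> fst w \<bullet> snd w}" for w
        by (intro closed_Collect_le continuous_intros)
      ultimately show ?thesis by auto
    qed
    then show "closed (\<Union>i\<in>I. D i)" using I by (intro closed_UN) auto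
    have "negligible ((\<lambda>y. y + x i) ` C i)" if i: "i \<in> {1..n} - I" for i
    proof -
      from i r0 have i': "i \<in> {1..n}" and ri: "r i = 0" by (force simp: I_def)+
      have "negligible ((\<lambda>y. y - c i) ` C i)"
      proof (rule negligible_of_point_contact[OF finW[OF i'] hullW[OF i'], of _ "- c i"])
        fix u v assume uv: "(u, v) \<in> W i"
        have "u = - c i" using inB[OF i' uv] ri by simp
        then show "v \<noteq> 0 \<and> (\<forall>y\<in>(\<lambda>y. y - c i) ` C i. y \<bullet> v \<le> - c i \<bullet> v)"
          using cW[OF i' uv] by (simp add: contact_pair_def)
      qed
      then have "negligible ((+) (x i + c i) ` (\<lambda>y. y - c i) ` C i)"
        by (rule negligible_translation)
      then show ?thesis by (simp add: image_image algebra_simps)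
    qed
    then show "negligible (\<Union>i\<in>{1..n}-I. (\<lambda>y. y + x i) ` C i)"
      by (intro negligible_Union) auto
    have "(\<lambda>y. y + x i) ` C i \<subseteq> D i" if i: "i \<in> I" for i
    proof -
      have "(y - c i) \<bullet> v \<le> u \<bullet> v" if "y \<in> C i" "(u, v) \<in> W i" for y u v
        using cW[of i u v] that i I by (auto simp: contact_pair_def)
      then show ?thesis by (auto simp: D_def)
    qed
    then have "(\<Union>i\<in>I. (\<lambda>y. y + x i) ` C i) \<subseteq> (\<Union>i\<in>I. D i)"
      by (rule UN_mono[OF subset_refl])
    moreover have "{1..n} = I \<union> ({1..n} - I)" using I by blast
    then have "(\<Union>i\<in>{1..n}. (\<lambda>y. y + x i) ` C i)
        = (\<Union>i\<in>I. (\<lambda>y. y + x i) ` C i) \<union> (\<Union>i\<in>{1..n}-I. (\<lambda>y. y + x i) ` C i)"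
      by (metis UN_Un)
    ultimately have "(\<Union>i\<in>{1..n}. (\<lambda>y. y + x i) ` C i)
        \<subseteq> (\<Union>i\<in>I. D i) \<union> (\<Union>i\<in>{1..n}-I. (\<lambda>y. y + x i) ` C i)"
      by (simp only: Un_mono subset_refl)
    with cov show "B \<subseteq> (\<Union>i\<in>I. D i) \<union> (\<Union>i\<in>{1..n}-I. (\<lambda>y. y + x i) ` C i)"
      by (rule subset_trans)
  qed
  moreover have "\<exists>p\<in>B. \<forall>i\<in>I. p \<notin> D i" if lt: "(\<Sum>i=1..n. r i) < 1"
  proof -
    define R where "R = (\<Sum>i\<in>I. r i)"
    have R0: "0 \<le> R" unfolding R_def using I r0 by (intro sum_nonneg) auto
    have "R \<le> (\<Sum>i=1..n. r i)" unfolding R_def using I r0 by (intro sum_mono2) auto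
    with lt have R1: "R < 1" by simp
    \<comment> \<open>Any \<open>t > 1\<close> with \<open>t * R \<le> 1\<close> would do; this
      choice also covers \<open>R = 0\<close>.\<close>
    define t where "t = 2 / (1 + R)"
    have t: "1 < t" "t * R \<le> 1" using R0 R1 by (auto simp: t_def field_simps)
    from intB obtain b0 where b0: "b0 \<in> interior B" by blast
    \<comment> \<open>The terms \<open>t *\<^sub>R c i\<close> cancel the shifts in
      \<open>u = r i *\<^sub>R b - c i\<close>, and \<open>b0\<close> takes up the remaining weight
      \<open>1 - t * R\<close>, so that \<open>p\<close> below is a convex combination of points of
      \<open>B\<close>.\<close>
    define y where "y = (1 - t * R) *\<^sub>R b0 + (\<Sum>i\<in>I. t *\<^sub>R c i)"
    obtain k where k: "\<And>i. i \<in> I \<Longrightarrow> k i \<in> W i"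
      and out: "\<And>i. i \<in> I \<Longrightarrow>
        fst (k i) \<bullet> snd (k i) < ((\<Sum>j\<in>I. t *\<^sub>R fst (k j)) - (x i + c i - y)) \<bullet> snd (k i)"
    \<comment> \<open>The image of \<open>b0\<close> in each inscribed copy strictly satisfies the
      constraints. Subtracting \<open>y\<close> from the shift moves the base point of Bang's points
      from 0 to \<open>y\<close>.\<close>
    proof (rule bang_lemma[of I W "\<lambda>i. r i *\<^sub>R b0 - c i" t "\<lambda>i. x i + c i - y"])
      show "(r i *\<^sub>R b0 - c i) \<bullet> v < u \<bullet> v" if "i \<in> I" "(u, v) \<in> W i" for i u v
        using that by (intro contact_pair_interior_less[OF cW _ b0]) (auto simp: I_def)
      show "u \<bullet> v' = u' \<bullet> v"
        if "i \<in> I" "j \<in> I" "i \<noteq> j" "(u, v) \<in> W i" "(u', v') \<in> W j" for i j u v u' v'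
        using that I by (intro sym[of i j]) auto
    qed (use I finW hullW t in blast)+
    have "\<exists>b\<in>B. fst (k i) = r i *\<^sub>R b - c i" if "i \<in> I" for i
      using inB[of i "fst (k i)" "snd (k i)"] k that I by auto
    then obtain b where b: "\<And>i. i \<in> I \<Longrightarrow> b i \<in> B \<and> fst (k i) = r i *\<^sub>R b i - c i"
      by metis
    define p where "p = y + (\<Sum>i\<in>I. t *\<^sub>R fst (k i))"
    have "(\<Sum>i\<in>I. t *\<^sub>R c i) + (\<Sum>i\<in>I. t *\<^sub>R fst (k i)) = (\<Sum>i\<in>I. (t * r i) *\<^sub>R b i)"
      unfolding sum.distrib[symmetric] by (intro sum.cong) (simp_all add: b scaleR_diff_right)
    then have p: "p = (1 - t * R) *\<^sub>R b0 + (\<Sum>i\<in>I. (t * r i) *\<^sub>R b i)"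
      by (simp add: p_def y_def add.assoc)
    have "p \<in> B"
    proof -
      \<comment> \<open>The index \<open>None\<close> carries the extra point \<open>b0\<close>, so
        that a single finite convex combination results.\<close>
      define a where "a = (\<lambda>i. case i of None \<Rightarrow> 1 - t * R | Some i \<Rightarrow> t * r i)"
      define e where "e = (\<lambda>i. case i of None \<Rightarrow> b0 | Some i \<Rightarrow> b i)"
      let ?J = "insert None (Some ` I)"
      have "(\<Sum>i\<in>?J. a i *\<^sub>R e i) \<in> B"
      proof (rule convex_sum[OF _ convB])
        show "sum a ?J = 1"
          using I by (simp add: a_def sum.reindex R_def sum_distrib_left)
        show "0 \<le> a i" if "i \<in> ?J" for i
          using that t r0 I by (auto simp: a_def)
        show "e i \<in> B" if "i \<in> ?J" for i
          using that b subsetD[OF interior_subset b0] by (auto simp: e_def)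
      qed (use I in auto)
      also have "(\<Sum>i\<in>?J. a i *\<^sub>R e i) = p"
        using I by (simp add: p a_def e_def sum.reindex)
      finally show ?thesis .
    qed
    moreover have "p \<notin> D i" if "i \<in> I" for i
    proof
      assume "p \<in> D i"
      then have "(p - x i - c i) \<bullet> snd (k i) \<le> fst (k i) \<bullet> snd (k i)"
        using k[OF that] by (auto simp: D_def)
      with out[OF that] show False
        by (simp add: p_def algebra_simps)
    qed
    ultimately show ?thesis by blast
  qed
  ultimately have "1 \<le> (\<Sum>i=1..n. r i)" by (meson UN_E linorder_not_le subsetD)
  moreover have "(\<Sum>i=1..n. inradius B (C i)) = ereal (\<Sum>i=1..n. r i)"
    using inr by simp
  ultimately show ?thesis by simp
qed

end
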